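(* Let $p$ be an odd prime, let $\mathbb{F}_p$ be the finite field with $p$ elements, and let $K_{p+1}$ be the complete graph on the vertex set $\mathbb{F}_p \cup \{c\}$, where $c$ is an extra point (the centre). Regard $0$ as a quadratic residue and $c$ as a quadratic non-residue. For $x,y\in\mathbb{F}_p$ define the length of the edge $\{x,y\}$ as $\ell(x,y)=\{x-y,\,y-x\}\subset \mathbb{F}_p^*$, and define $\ell(c,x)=\infty$ for every $x\in\mathbb{F}_p$. Then there exists a $1$-factor $F$ of $K_{p+1}$ (a set of pairwise disjoint edges covering all vertices) such that (1) each edge of $F$ joins a quadratic residue and a quadratic non-residue, and (2) the lengths of the edges in $F$ are pairwise distinct. *)

theory Defs
  imports "HOL-Number_Theory.Number_Theory"
begin

text \<open>Vertices of K_{p+1}: Some x for x in F_p = {0..p-1} (as integers mod p),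
  None is the centre c.\<close>

definition vertices :: "int \<Rightarrow> int option set" where
  "vertices p = insert None (Some ` {0..p-1})"

definition edges :: "int \<Rightarrow> int option set set" where
  "edges p = {{u, v} | u v. u \<in> vertices p \<and> v \<in> vertices p \<and> u \<noteq> v}"

definition one_factor :: "int \<Rightarrow> int option set set \<Rightarrow> bool" where
  "one_factor p F \<longleftrightarrow> F \<subseteq> edges p
     \<and> (\<forall>e\<in>F. \<forall>e'\<in>F. e \<noteq> e' \<longrightarrow> e \<inter> e' = {})
     \<and> (\<forall>v\<in>vertices p. \<exists>e\<in>F. v \<in> e)"

text \<open>Quadratic residue status of a vertex: 0 counts as a residue (automatic from QuadRes),
  the centre counts as a non-residue.\<close>
definition is_residue :: "int \<Rightarrow> int option \<Rightarrow> bool" where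
  "is_residue p v = (case v of None \<Rightarrow> False | Some x \<Rightarrow> QuadRes p x)"

text \<open>Length of an edge: Some {x-y, y-x} (in F_p^*, represented by residues mod p) for
  x,y in F_p; None represents \<infinity> for edges through the centre.\<close>
definition len :: "int \<Rightarrow> int option \<Rightarrow> int option \<Rightarrow> int set option" where
  "len p u v = (case (u, v) of
      (Some x, Some y) \<Rightarrow> Some {(x - y) mod p, (y - x) mod p}
    | _ \<Rightarrow> None)"

definition edge_len :: "int \<Rightarrow> int option set \<Rightarrow> int set option" where
  "edge_len p e = (THE l. \<exists>u v. e = {u, v} \<and> u \<noteq> v \<and> l = len p u v)"

end

theory Submission
  imports Defs
begin

text \<open>
  Put $n = (p - 1)/2$ and let $g$ be a primitive root. There are $n$ finite lengths, so apart from
  the edge at $c$ the lengths of the edges are a system of representatives of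
  $\mathbb{F}_p^*/\{\pm 1\}$; as $-1 = g^n$, this means that the discrete logarithms of the
  differences are distinct modulo $n$.

  If $n$ is odd, the pairs $\{x, -x\}$ with $x$ a residue work, together with $\{c, 0\}$.

  If $n$ is even and has an odd divisor $q > 1$, let $h$ have order $q$. Choose a set $S$ of residues
  which is invariant under $h$ and contains exactly one of $x$ and $-x$ for each nonzero residue $x$.
  Pair $x \in S$ with $ax$ and $x \notin S$ with $ahx$, where $a$ is a non-residue such that exactly
  one of $1 - a$ and $1 - ah$ is a residue. Such an $a$ exists: otherwise
  $(1 - y)^n = (1 - hy)^n$ for all non-residues $y$, and summing $y^{n-1}(1 - ty)^n$ over them gives
  $n^2 t$, so that $h = 1$.

  The remaining primes $p > 5$ are Fermat primes, for which $3$ is a primitive root. Start from pairs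
  $\{3^e, 3^{e \pm 1}\}$, with sign $+$ for even $e < n$ and $-$ for even $e > n$. The vertex
  $3^n = -1$ is joined to the remaining non-residue $1/3$, and the residue $u = \pm 2$ for
  which the sign is $-$ is joined to $c$, leaving its partner $u/3$ to $0$. The two new lengths
  $4/3$ and $2/3$ are the ones that were missing. For $p = 5$ the edges
  $\{0, 2\}$, $\{4, 3\}$, $\{1, c\}$ will do.
\<close>

definition has_balanced_rainbow_factor :: "int \<Rightarrow> bool" where
  "has_balanced_rainbow_factor p \<longleftrightarrow> (\<exists>F. one_factor p F
    \<and> (\<forall>e\<in>F. \<exists>u v. e = {u, v} \<and> is_residue p u \<and> \<not> is_residue p v)
    \<and> inj_on (edge_len p) F)"

subsection \<open>Primitive roots\<close>

text \<open>\<open>power_cong_iff\<close> says that \<open>g\<close> has order exactly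
  \<open>2 * n\<close>, that is, \<open>p - 1\<close>. As an equivalence it serves for passing
  between residues and discrete logarithms in both directions.\<close>

locale primitive_root =
  fixes p g :: int and n :: nat
  assumes p_prime: "prime p"
    and p_eq: "p = 2 * int n + 1"
    and power_cong_iff: "[g ^ a = g ^ b] (mod p) \<longleftrightarrow> [a = b] (mod (2 * n))"
begin

lemma n_pos: "n > 0"
  using p_prime p_eq by (cases n) auto

lemma p_gt_2: "p > 2"
  using n_pos p_eq by simp

lemma not_dvd_power: "\<not> p dvd g ^ a"
proof
  assume "p dvd g ^ a"
  then have "[g ^ a = g ^ Suc a] (mod p)"
    by (simp add: cong_iff_dvd_diff)
  then have "[a = Suc a] (mod (2 * n))"
    using power_cong_iff by blast
  then have "[a + 0 = a + 1] (mod (2 * n))" by simp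
  then have "2 * n dvd 1"
    unfolding cong_add_lcancel_nat by (simp add: cong_sym_eq[of 0] cong_0_iff)
  then show False by simp
qed

text \<open>\<open>g ^ n\<close> is a square root of 1 and differs from 1, as \<open>2 * n\<close>
  does not divide \<open>n\<close>.\<close>

lemma power_n: "[g ^ n = -1] (mod p)"
proof -
  have "[g ^ (2 * n) = g ^ 0] (mod p)"
    unfolding power_cong_iff by (simp add: cong_def)
  then have "p dvd (g ^ n - 1) * (g ^ n + 1)"
    by (simp add: cong_iff_dvd_diff mult_2_right power_add algebra_simps)
  moreover have "\<not> [g ^ n = g ^ 0] (mod p)"
    unfolding power_cong_iff using n_pos by (simp add: cong_def)
  then have "\<not> p dvd g ^ n - 1"
    by (simp add: cong_iff_dvd_diff)
  ultimately have "p dvd g ^ n + 1"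
    using p_prime prime_dvd_mult_iff by blast
  then show ?thesis by (simp add: cong_iff_dvd_diff)
qed

lemma power_add_n: "[g ^ (a + n) = - (g ^ a)] (mod p)"
  using cong_mult[OF cong_refl[of "g ^ a"] power_n] by (simp add: power_add)

lemma inj_on_power_mod: "inj_on (\<lambda>e. g ^ e mod p) {..<2 * n}"
proof (rule inj_onI)
  fix a b assume "a \<in> {..<2 * n}" "b \<in> {..<2 * n}" "g ^ a mod p = g ^ b mod p"
  then show "a = b"
    using power_cong_iff[of a b] by (simp add: cong_def)
qed

lemma image_power_mod: "(\<lambda>e. g ^ e mod p) ` {..<2 * n} = {1..p - 1}"
proof (rule card_subset_eq)
  show "(\<lambda>e. g ^ e mod p) ` {..<2 * n} \<subseteq> {1..p - 1}"
  proof (rule image_subsetI)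
    fix e
    have "g ^ e mod p \<noteq> 0" using not_dvd_power by (simp add: dvd_eq_mod_eq_0)
    moreover have "0 \<le> g ^ e mod p" "g ^ e mod p < p" using p_gt_2 by auto
    ultimately show "g ^ e mod p \<in> {1..p - 1}" by simp
  qed
  show "card ((\<lambda>e. g ^ e mod p) ` {..<2 * n}) = card {1..p - 1}"
    using inj_on_power_mod p_eq by (simp add: card_image)
qed auto

lemma power_rep:
  assumes "\<not> p dvd x"
  obtains e where "e < 2 * n" "[x = g ^ e] (mod p)"
proof -
  have "x mod p \<noteq> 0" using assms by (simp add: dvd_eq_mod_eq_0)
  moreover have "0 \<le> x mod p" "x mod p < p" using p_gt_2 by auto
  ultimately have "x mod p \<in> {1..p - 1}" by simp
  then obtain e where "e < 2 * n" "x mod p = g ^ e mod p"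
    unfolding image_power_mod[symmetric] by auto
  then show thesis using that by (simp add: cong_def)
qed

lemma even_cong: "[a = b] (mod (2 * n)) \<Longrightarrow> even a \<longleftrightarrow> even b"
  using cong_dvd_iff[OF cong_dvd_modulus_nat[of a b "2 * n" 2]] by simp

text \<open>A square root of \<open>g ^ e\<close> is again some \<open>g ^ f\<close>, and the
  modulus \<open>2 * n\<close> of the exponents is even, so \<open>f * 2\<close> and
  \<open>e\<close> have the same parity.\<close>

lemma QuadRes_power_iff: "QuadRes p (g ^ e) \<longleftrightarrow> even e"
proof
  assume "QuadRes p (g ^ e)"
  then obtain y where y: "[y ^ 2 = g ^ e] (mod p)"
    unfolding QuadRes_def by blast
  have "\<not> p dvd y"
  proof
    assume "p dvd y"
    then have "p dvd y ^ 2" by (simp add: power2_eq_square)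
    then show False using cong_dvd_iff[OF y] not_dvd_power by blast
  qed
  then obtain f where "[y = g ^ f] (mod p)"
    by (rule power_rep)
  then have "[g ^ (f * 2) = g ^ e] (mod p)"
    using y cong_trans[OF cong_sym[OF cong_pow[of y "g ^ f" p 2]] y] by (simp add: power_mult)
  then have "[f * 2 = e] (mod (2 * n))"
    by (simp add: power_cong_iff)
  then show "even e"
    using even_cong by fastforce
next
  assume "even e"
  then show "QuadRes p (g ^ e)"
    unfolding QuadRes_def
    by (intro exI[of _ "g ^ (e div 2)"]) (simp flip: power_mult)
qed

end

lemma primitive_root_exists:
  fixes p :: int
  assumes "prime p" "odd p"
  obtains g n where "primitive_root p g n"
proof -
  define P where "P = nat p"
  have P: "prime P" "int P = p"
    using assms(1) prime_gt_0_int[of p] unfolding P_def by simp_all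
  then obtain g where g: "residue_primroot P g"
    using prime_primitive_root_exists[of P] prime_gt_1_nat[of P] by auto
  then have cop: "coprime P g" and ord: "ord P g = totient P"
    by (auto simp: residue_primroot_def)
  obtain n where n: "p = 2 * int n + 1"
  proof -
    have "p > 0" using assms(1) prime_gt_0_int by blast
    then show thesis using assms(2) that[of "nat ((p - 1) div 2)"] by auto
  qed
  have "ord P g = 2 * n"
    using P n by (simp add: ord totient_prime)
  then have "[int g ^ a = int g ^ b] (mod p) \<longleftrightarrow> [a = b] (mod (2 * n))" for a b
    using order_divides_expdiff[OF cop, of a b] cong_int_iff[of "g ^ a" "g ^ b" P] P(2)
    by simp
  then show thesis
    using that[of "int g" n] assms n by (simp add: primitive_root_def)
qed

subsection \<open>Matchings given by discrete logarithms\<close>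

lemma edge_len_pair:
  assumes "u \<noteq> v"
  shows "edge_len p {u, v} = len p u v"
proof -
  have "len p a b = len p b a" for a b
    by (auto simp: len_def insert_commute split: option.splits)
  then show ?thesis
    unfolding edge_len_def using assms
    by (intro the_equality) (auto simp: doubleton_eq_iff)
qed

lemma QuadRes_mod: "QuadRes p (x mod p) \<longleftrightarrow> QuadRes p x"
  by (simp add: QuadRes_def cong_def)

context primitive_root
begin

text \<open>As -1 is \<open>g ^ n\<close>, a change of sign adds \<open>n\<close> to the logarithm.
  So differences whose logarithms are distinct mod \<open>n\<close> have distinct lengths.\<close>

lemma cong_n_if_power_cong:
  assumes "[g ^ a = g ^ b] (mod p) \<or> [g ^ a = - (g ^ b)] (mod p)"
  shows "[a = b] (mod n)"
proof -
  have "[g ^ a = g ^ b] (mod p) \<or> [g ^ a = g ^ (b + n)] (mod p)"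
    using assms cong_trans[OF _ cong_sym[OF power_add_n]] by blast
  then have "[a = b] (mod (2 * n)) \<or> [a = b + n] (mod (2 * n))"
    by (simp add: power_cong_iff)
  then have "[a = b] (mod n) \<or> [a = b + n] (mod n)"
    using cong_dvd_modulus_nat dvd_triv_right by blast
  then show ?thesis by (simp add: cong_def)
qed

text \<open>
  The nonzero residue $g^u$ is replaced by the residue $0$ and joined to the centre. If $u$ is odd or
  at least $2n$, nothing is replaced and the centre is joined to $0$.
\<close>
lemma rainbow_one_factor:
  fixes Y L :: "nat \<Rightarrow> nat" and u :: nat
  defines "E \<equiv> {e. e < 2 * n \<and> even e}"
  defines "r \<equiv> \<lambda>e. if e = u then 0 else g ^ e"
  assumes Y_odd: "\<And>e. e \<in> E \<Longrightarrow> odd (Y e)"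
    and Y_inj: "\<And>e e'. e \<in> E \<Longrightarrow> e' \<in> E \<Longrightarrow> [Y e = Y e'] (mod (2 * n)) \<Longrightarrow> e = e'"
    and L: "\<And>e. e \<in> E \<Longrightarrow> [r e - g ^ Y e = g ^ L e] (mod p)"
    and L_inj: "\<And>e e'. e \<in> E \<Longrightarrow> e' \<in> E \<Longrightarrow> [L e = L e'] (mod n) \<Longrightarrow> e = e'"
  shows "has_balanced_rainbow_factor p"
proof -
  define R where "R e = r e mod p" for e
  define W where "W e = g ^ Y e mod p" for e
  define r0 where "r0 = (if u \<in> E then g ^ u mod p else 0)"
  define edge where "edge e = {Some (R e), Some (W e)}" for e
  define F where "F = insert {None, Some r0} (edge ` E)"
  have range: "x mod p \<in> {0..p - 1}" for x
    using p_gt_2 pos_mod_bound[of p x] by simp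
  have [simp]: "g ^ e mod p \<noteq> 0" for e
    using not_dvd_power by (simp add: dvd_eq_mod_eq_0)
  have power_eq: "g ^ a mod p = g ^ b mod p \<longleftrightarrow> [a = b] (mod (2 * n))" for a b
    using power_cong_iff by (simp add: cong_def)
  have E_eq: "a = b" if "a \<in> E" "b \<in> E" "[a = b] (mod (2 * n))" for a b
    using that by (auto simp: E_def cong_def)
  have "QuadRes p 0"
    unfolding QuadRes_def by (intro exI[of _ 0]) simp
  then have R_res: "QuadRes p (R e)" if "e \<in> E" for e
    using that unfolding R_def QuadRes_mod by (simp add: r_def E_def QuadRes_power_iff)
  have r0_res: "QuadRes p r0"
    using \<open>QuadRes p 0\<close> by (simp add: r0_def E_def QuadRes_mod QuadRes_power_iff)
  have W_nonres: "\<not> QuadRes p (W e)" if "e \<in> E" for e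
    using Y_odd[OF that] by (simp add: W_def QuadRes_mod QuadRes_power_iff)
  have R_ne_W: "R e \<noteq> W e'" if "e \<in> E" "e' \<in> E" for e e'
    using R_res W_nonres that by metis
  have r0_ne_W: "r0 \<noteq> W e" if "e \<in> E" for e
    using r0_res W_nonres that by metis
  have r0_ne_R: "r0 \<noteq> R e" if "e \<in> E" for e
    using that E_eq by (auto simp: r0_def R_def r_def power_eq)
  have R_inj: "e = e'" if "e \<in> E" "e' \<in> E" "R e = R e'" for e e'
    using that E_eq by (auto simp: R_def r_def power_eq split: if_splits)
  have W_inj: "e = e'" if "e \<in> E" "e' \<in> E" "W e = W e'" for e e'
    using that Y_inj by (simp add: W_def power_eq)
  \<comment> \<open>\<open>Y\<close> maps \<open>E\<close> injectively mod \<open>2 * n\<close> into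
    the odd exponents, which are as many as the even ones, so every non-residue is reached.\<close>
  have odd_covered: "\<exists>e'\<in>E. [Y e' = e] (mod (2 * n))" if "e < 2 * n" "odd e" for e
  proof -
    define D where "D = {e. e < 2 * n \<and> odd e}"
    have "Suc ` E = D"
    proof (intro equalityI subsetI)
      fix d assume "d \<in> D"
      then have "d = Suc (d - 1)" "d - 1 \<in> E"
        by (auto simp: D_def E_def elim!: oddE)
      then show "d \<in> Suc ` E" by blast
    qed (clarsimp simp: E_def D_def, presburger)
    then have card_eq: "card D = card E"
      using card_image[of Suc E] by simp
    have "(\<lambda>e. Y e mod (2 * n)) ` E = D"
    proof (rule card_subset_eq)
      show "(\<lambda>e. Y e mod (2 * n)) ` E \<subseteq> D"
        using Y_odd n_pos by (auto simp: D_def dvd_mod_iff)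
      have "inj_on (\<lambda>e. Y e mod (2 * n)) E"
        using Y_inj by (auto intro!: inj_onI simp: cong_def)
      then show "card ((\<lambda>e. Y e mod (2 * n)) ` E) = card D"
        by (simp add: card_image card_eq)
    qed (simp add: D_def)
    moreover have "e \<in> D" using that by (simp add: D_def)
    ultimately obtain e' where "e' \<in> E" "e = Y e' mod (2 * n)" by blast
    then show ?thesis by (auto simp: cong_def)
  qed
  have disjoint: "edge e \<inter> edge e' = {}" if "e \<in> E" "e' \<in> E" "e \<noteq> e'" for e e'
    using that R_inj W_inj R_ne_W by (auto simp: edge_def)
  have disjoint_centre: "{None, Some r0} \<inter> edge e = {}" if "e \<in> E" for e
    using that r0_ne_R r0_ne_W by (auto simp: edge_def)
  have "F \<subseteq> edges p"
  proof -
    have "r0 \<in> {0..p - 1}"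
      using range[of "g ^ u"] p_gt_2 by (auto simp: r0_def)
    then have "{None, Some r0} \<in> edges p"
      unfolding edges_def vertices_def by blast
    moreover have "edge e \<in> edges p" if "e \<in> E" for e
      using R_ne_W[OF that that] range[of "r e"] range[of "g ^ Y e"]
      unfolding edges_def vertices_def edge_def R_def W_def by blast
    ultimately show ?thesis by (auto simp: F_def)
  qed
  moreover have "\<forall>e\<in>F. \<forall>e'\<in>F. e \<noteq> e' \<longrightarrow> e \<inter> e' = {}"
    using disjoint disjoint_centre unfolding F_def
    by (smt (verit) Int_commute image_iff insert_iff)
  moreover have "\<exists>e\<in>F. v \<in> e" if "v \<in> vertices p" for v
  proof (cases v)
    case None
    then show ?thesis by (auto simp: F_def)
  next
    case (Some x)
    then have x: "x \<in> {0..p - 1}" using that by (auto simp: vertices_def)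
    have covered: ?thesis if "x = r0 \<or> (\<exists>e\<in>E. x = R e \<or> x = W e)"
      using that Some by (auto simp: F_def edge_def)
    show ?thesis
    proof (cases "x = 0")
      case True
      then have "x = r0 \<or> (u \<in> E \<and> x = R u)"
        by (auto simp: r0_def R_def r_def)
      then show ?thesis using covered by blast
    next
      case False
      then have "x \<in> {1..p - 1}" using x by auto
      then obtain e where e: "e < 2 * n" "x = g ^ e mod p"
        unfolding image_power_mod[symmetric] by auto
      show ?thesis
      proof (cases "even e")
        case True
        then have "e \<in> E" using e by (simp add: E_def)
        moreover have "x = (if e = u then r0 else R e)"
          using \<open>e \<in> E\<close> e by (auto simp: r0_def R_def r_def)
        ultimately show ?thesis using covered by metis
      next
        case False
        then obtain e' where "e' \<in> E" "[Y e' = e] (mod (2 * n))"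
          using odd_covered e by blast
        then have "x = W e'" using e power_eq by (simp add: W_def cong_sym_eq)
        then show ?thesis using covered \<open>e' \<in> E\<close> by blast
      qed
    qed
  qed
  ultimately have "one_factor p F" by (simp add: one_factor_def)
  moreover have "\<exists>u v. e = {u, v} \<and> is_residue p u \<and> \<not> is_residue p v" if "e \<in> F" for e
  proof -
    consider "e = {Some r0, None}" | e' where "e' \<in> E" "e = {Some (R e'), Some (W e')}"
      using \<open>e \<in> F\<close> by (auto simp: F_def edge_def)
    then show ?thesis
    proof cases
      case 1
      moreover have "is_residue p (Some r0)" "\<not> is_residue p None"
        using r0_res by (simp_all add: is_residue_def)
      ultimately show ?thesis by blast
    next
      case 2
      moreover have "is_residue p (Some (R e'))" "\<not> is_residue p (Some (W e'))"
        using R_res W_nonres \<open>e' \<in> E\<close> by (simp_all add: is_residue_def)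
      ultimately show ?thesis by blast
    qed
  qed
  moreover have "inj_on (edge_len p) F"
  proof -
    have len_edge: "edge_len p (edge e) = Some {(R e - W e) mod p, (W e - R e) mod p}"
      if "e \<in> E" for e
      using R_ne_W[OF that that] by (simp add: edge_def edge_len_pair len_def)
    have len_centre: "edge_len p {None, Some r0} = None"
      by (simp add: edge_len_pair len_def)
    have "e = e'" if "e \<in> E" "e' \<in> E" "edge_len p (edge e) = edge_len p (edge e')" for e e'
    proof -
      have diff: "[R e - W e = g ^ L e] (mod p)" if "e \<in> E" for e
        using L[OF that] by (simp add: R_def W_def cong_def mod_simps)
      have "[R e - W e = R e' - W e'] (mod p) \<or> [R e - W e = - (R e' - W e')] (mod p)"
        using that len_edge by (auto simp: doubleton_eq_iff cong_def)
      then have "[g ^ L e = g ^ L e'] (mod p) \<or> [g ^ L e = - (g ^ L e')] (mod p)"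
        using diff[OF that(1)] diff[OF that(2)]
        by (meson cong_minus_minus_iff cong_sym cong_trans)
      then show "e = e'"
        using cong_n_if_power_cong L_inj that by blast
    qed
    then have "inj_on (edge_len p) (edge ` E)"
      by (intro inj_onI) blast
    then show ?thesis
      unfolding F_def using len_edge len_centre by auto
  qed
  ultimately show ?thesis
    unfolding has_balanced_rainbow_factor_def by blast
qed

subsection \<open>The case $p \equiv 3 \pmod 4$\<close>

text \<open>Adding the odd number \<open>n\<close> to the exponent negates and changes the residue
  status. The difference of \<open>x\<close> and \<open>-x\<close> is \<open>2 * x\<close>, whose
  logarithm is that of \<open>x\<close> shifted by \<open>c\<close>.\<close>

lemma rainbow_one_factor_odd:
  assumes "odd n"
  shows "has_balanced_rainbow_factor p"
proof -
  have "\<not> p dvd 2"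
    using p_gt_2 zdvd_imp_le by force
  then obtain c where c: "[2 = g ^ c] (mod p)"
    by (rule power_rep)
  show ?thesis
  proof (rule rainbow_one_factor[where u = "2 * n" and Y = "\<lambda>e. e + n" and L = "\<lambda>e. c + e"];
      (elim CollectE conjE)?)
    fix e e' assume *: "e < 2 * n" "e' < 2 * n" "[e + n = e' + n] (mod (2 * n))"
    then have "[e = e'] (mod (2 * n))"
      by (simp add: cong_add_rcancel_nat)
    then show "e = e'" using * by (simp add: cong_def)
  next
    fix e assume "e < 2 * n"
    have "[g ^ e - g ^ (e + n) = g ^ e - - (g ^ e)] (mod p)"
      using power_add_n by (intro cong_diff) auto
    also have "g ^ e - - (g ^ e) = 2 * g ^ e" by simp
    also have "[2 * g ^ e = g ^ c * g ^ e] (mod p)"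
      using c by (rule cong_scalar_right)
    finally show "[(if e = 2 * n then 0 else g ^ e) - g ^ (e + n) = g ^ (c + e)] (mod p)"
      using \<open>e < 2 * n\<close> by (simp add: power_add)
  next
    fix e e' assume *: "e < 2 * n" "even e" "e' < 2 * n" "even e'" "[c + e = c + e'] (mod n)"
    then have "[e = e'] (mod n)"
      by (simp add: cong_add_lcancel_nat)
    \<comment> \<open>2 is prime to the odd number \<open>n\<close>, so for even exponents agreement
      mod \<open>n\<close> lifts to \<open>2 * n\<close>.\<close>
    moreover have "[e = e'] (mod 2)" using * by (simp add: cong_def)
    ultimately have "[e = e'] (mod (2 * n))"
      using assms by (intro coprime_cong_mult_nat) auto
    then show "e = e'" using * by (simp add: cong_def)
  qed (use assms in auto)
qed

subsection \<open>Odd divisors of $(p - 1)/2$\<close>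

text \<open>The sum of the \<open>k\<close>-th powers of the non-residues is geometric. Its ratio
  \<open>g ^ (2 * k)\<close> has \<open>n\<close>-th power 1 but is not 1 itself.\<close>

lemma sum_power_nonresidues:
  assumes "\<not> n dvd k"
  shows "[(\<Sum>i<n. g ^ ((2 * i + 1) * k)) = 0] (mod p)"
proof -
  define S where "S = (\<Sum>i<n. g ^ ((2 * i + 1) * k))"
  have S_eq: "S = g ^ k * (\<Sum>i<n. (g ^ (2 * k)) ^ i)"
    unfolding S_def sum_distrib_left
    by (intro sum.cong) (simp_all add: algebra_simps power_add flip: power_mult)
  have "(g ^ (2 * k) - 1) * S = g ^ k * ((g ^ (2 * k) - 1) * (\<Sum>i<n. (g ^ (2 * k)) ^ i))"
    by (simp add: S_eq)
  also have "\<dots> = g ^ k * ((g ^ (2 * k)) ^ n - 1)"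
    by (simp add: power_diff_1_eq)
  finally have *: "(g ^ (2 * k) - 1) * S = g ^ k * (g ^ (2 * k * n) - g ^ 0)"
    by (simp flip: power_mult)
  have "[g ^ (2 * k * n) = g ^ 0] (mod p)"
    unfolding power_cong_iff by (simp add: cong_0_iff)
  then have "p dvd (g ^ (2 * k) - 1) * S"
    unfolding * by (simp add: cong_iff_dvd_diff)
  moreover have "\<not> [g ^ (2 * k) = g ^ 0] (mod p)"
    unfolding power_cong_iff using assms by (simp add: cong_0_iff)
  then have "\<not> p dvd g ^ (2 * k) - 1"
    by (simp add: cong_iff_dvd_diff)
  ultimately have "p dvd S"
    using p_prime prime_dvd_mult_iff by blast
  then show ?thesis by (simp add: S_def cong_0_iff)
qed

text \<open>After binomial expansion, the \<open>j\<close>-th term contains the sum of the powers of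
  exponent \<open>n - 1 + j\<close> of the non-residues. It vanishes unless \<open>n\<close> divides
  the exponent, which leaves only \<open>j = 1\<close>.\<close>

lemma sum_weighted_power:
  fixes t :: int
  assumes "n > 1"
  shows "[(\<Sum>i<n. g ^ ((2 * i + 1) * (n - 1)) * (1 - t * g ^ (2 * i + 1)) ^ n) = int n ^ 2 * t] (mod p)"
proof -
  define T where "T j = (\<Sum>i<n. g ^ ((2 * i + 1) * (n - 1 + j)))" for j
  have "(\<Sum>i<n. g ^ ((2 * i + 1) * (n - 1)) * (1 - t * g ^ (2 * i + 1)) ^ n)
      = (\<Sum>i<n. \<Sum>j\<le>n. int (n choose j) * (- t) ^ j * g ^ ((2 * i + 1) * (n - 1 + j)))"
  proof (rule sum.cong[OF refl])
    fix i :: nat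
    define k where "k = 2 * i + 1"
    have "(1 - t * g ^ k) ^ n = (- t * g ^ k + 1) ^ n"
      by (simp add: algebra_simps)
    also have "\<dots> = (\<Sum>j\<le>n. int (n choose j) * (- t * g ^ k) ^ j)"
      by (subst binomial_ring) simp
    also have "\<dots> = (\<Sum>j\<le>n. int (n choose j) * (- t) ^ j * g ^ (k * j))"
      by (simp only: power_mult_distrib power_mult mult.assoc)
    finally have "g ^ (k * (n - 1)) * (1 - t * g ^ k) ^ n
      = (\<Sum>j\<le>n. int (n choose j) * (- t) ^ j * g ^ (k * (n - 1 + j)))"
      by (simp add: sum_distrib_left add_mult_distrib2 power_add mult_ac)
    then show "g ^ ((2 * i + 1) * (n - 1)) * (1 - t * g ^ (2 * i + 1)) ^ n
      = (\<Sum>j\<le>n. int (n choose j) * (- t) ^ j * g ^ ((2 * i + 1) * (n - 1 + j)))"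
      unfolding k_def .
  qed
  also have "\<dots> = (\<Sum>j\<le>n. int (n choose j) * (- t) ^ j * T j)"
    unfolding T_def sum_distrib_left by (rule sum.swap)
  also have "[\<dots> = (\<Sum>j\<le>n. if j = 1 then int n ^ 2 * t else 0)] (mod p)"
  proof (rule cong_sum)
    fix j assume "j \<in> {..n}"
    show "[int (n choose j) * (- t) ^ j * T j = (if j = 1 then int n ^ 2 * t else 0)] (mod p)"
    proof (cases "j = 1")
      case True
      \<comment> \<open>Each of the \<open>n\<close> summands of \<open>T 1\<close> is the
        \<open>n\<close>-th power of a non-residue, that is, -1.\<close>
      have "[g ^ ((2 * i + 1) * n) = -1] (mod p)" for i
        using cong_pow[OF power_n, of "2 * i + 1"]
        by (simp add: mult.commute power_add flip: power_mult)
      then have "[T j = (\<Sum>i<n. -1)] (mod p)"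
        unfolding T_def using True assms by (intro cong_sum) simp
      then have "[int n * - t * T j = int n * - t * - int n] (mod p)"
        by (intro cong_scalar_left) simp
      then show ?thesis using True by (simp add: power2_eq_square mult_ac)
    next
      case False
      \<comment> \<open>The exponent lies between \<open>n - 1 > 0\<close> and
        \<open>2 * n - 1\<close>, where \<open>n\<close> is the only multiple of
        \<open>n\<close>.\<close>
      have "\<not> n dvd n - 1 + j"
      proof
        assume "n dvd n - 1 + j"
        then obtain q where q: "n - 1 + j = n * q" ..
        then have "n * q < n * 2" "n * q \<noteq> n * 1" "n * q \<noteq> n * 0"
          unfolding q[symmetric] using False assms \<open>j \<in> {..n}\<close> by auto
        then have "q < 2" "q \<noteq> 1" "q \<noteq> 0" by simp_all
        then show False by linarith
      qed
      then have "[T j = 0] (mod p)"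
        unfolding T_def by (rule sum_power_nonresidues)
      then show ?thesis
        using False by (simp add: cong_0_iff)
    qed
  qed
  also have "(\<Sum>j\<le>n. if j = 1 then int n ^ 2 * t else 0) = int n ^ 2 * t"
    using assms by simp
  finally show ?thesis .
qed

text \<open>\<open>odd (l + m)\<close> says that exactly one of the two differences is a residue.
  Were there no such \<open>\<alpha>\<close>, \<open>sum_weighted_power\<close> would take the same
  value at \<open>t = 1\<close> and \<open>t = g ^ H\<close>.\<close>

lemma nonresidue_shift:
  assumes "n > 1" "\<not> 2 * n dvd H" "even H"
  obtains \<alpha> l m where "odd \<alpha>" "[1 - g ^ \<alpha> = g ^ l] (mod p)" "[1 - g ^ (\<alpha> + H) = g ^ m] (mod p)"
    "odd (l + m)"
proof (rule ccontr)
  note solution = that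
  assume no: "\<not> thesis"
  have unit: "\<not> p dvd 1 - g ^ a" if "odd a" for a
  proof
    assume "p dvd 1 - g ^ a"
    then have "[g ^ 0 = g ^ a] (mod p)" by (simp add: cong_iff_dvd_diff)
    then show False using that even_cong unfolding power_cong_iff by fastforce
  qed
  then have rep: "\<exists>l. [1 - g ^ a = g ^ l] (mod p)" if "odd a" for a
    using that power_rep by metis
  have "[(1 - g ^ a) ^ n = (1 - g ^ (a + H)) ^ n] (mod p)" if "odd a" for a
  proof -
    obtain l where l: "[1 - g ^ a = g ^ l] (mod p)"
      using rep[OF \<open>odd a\<close>] ..
    obtain m where m: "[1 - g ^ (a + H) = g ^ m] (mod p)"
      using rep[of "a + H"] \<open>odd a\<close> \<open>even H\<close> by auto
    have "even (l + m)"
      using no l m \<open>odd a\<close> solution by blast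
    then have "[(g ^ l) ^ n = (g ^ m) ^ n] (mod p)"
    proof -
      \<comment> \<open>Euler's criterion, in terms of logarithms.\<close>
      have "[(g ^ i) ^ n = (-1) ^ i] (mod p)" for i
        using cong_pow[OF power_n, of i] by (simp add: mult.commute flip: power_mult)
      moreover have "(-1 :: int) ^ l = (-1) ^ m"
        using \<open>even (l + m)\<close> by (simp add: minus_one_power_iff)
      ultimately show ?thesis by (metis cong_sym cong_trans)
    qed
    then show ?thesis
      using cong_pow[OF l, of n] cong_pow[OF m, of n] by (meson cong_sym cong_trans)
  qed
  then have shift: "[(1 - 1 * g ^ a) ^ n = (1 - g ^ H * g ^ a) ^ n] (mod p)" if "odd a" for a
    using that by (simp add: power_add mult.commute[of "g ^ H"])
  have "[(\<Sum>i<n. g ^ ((2 * i + 1) * (n - 1)) * (1 - 1 * g ^ (2 * i + 1)) ^ n)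
      = (\<Sum>i<n. g ^ ((2 * i + 1) * (n - 1)) * (1 - g ^ H * g ^ (2 * i + 1)) ^ n)] (mod p)"
    by (intro cong_sum cong_scalar_left shift) simp
  then have "[int n ^ 2 * 1 = int n ^ 2 * g ^ H] (mod p)"
    using sum_weighted_power[OF \<open>n > 1\<close>] by (meson cong_sym cong_trans)
  moreover have "coprime (int n ^ 2) p"
  proof -
    have "\<not> p dvd int n"
      using n_pos p_eq zdvd_imp_le[of p "int n"] by linarith
    then show ?thesis
      using p_prime by (simp add: prime_imp_coprime coprime_commute)
  qed
  ultimately have "[g ^ H = g ^ 0] (mod p)"
    using cong_mult_lcancel[of "int n ^ 2" p 1 "g ^ H"] by (simp add: cong_sym)
  then show False
    using assms(2) unfolding power_cong_iff by (simp add: cong_0_iff)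
qed

lemma rainbow_one_factor_odd_divisor:
  assumes "even n" "odd q" "q dvd n" "q > 1"
  shows "has_balanced_rainbow_factor p"
proof -
  obtain k where k: "n = q * k" using \<open>q dvd n\<close> ..
  have "k > 0" using n_pos k by (cases k) auto
  obtain j where j: "q = 2 * j + 1" using \<open>odd q\<close> by (rule oddE)
  \<comment> \<open>Since \<open>2 * n = q * H\<close>, the order of \<open>g ^ H\<close> is
    \<open>q\<close>. \<open>S\<close> takes the first half of each period of length
    \<open>H\<close>: adding \<open>H\<close> preserves it, and adding \<open>n\<close>, an odd
    multiple of \<open>k\<close>, complements it.\<close>
  define H where "H = 2 * k"
  define S where "S e \<longleftrightarrow> e mod H < k" for e
  have S_cong: "S a \<longleftrightarrow> S b" if "[a = b] (mod (2 * n))" for a b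
    using cong_dvd_modulus_nat[OF that, of H] k by (simp add: S_def H_def cong_def)
  have S_add_n: "S (e + n) \<longleftrightarrow> \<not> S e" for e
  proof -
    have "e + n = (e + k) + H * j"
      by (simp add: H_def k j algebra_simps)
    then have "(e + n) mod H = (e + k) mod H"
      by (metis mod_mult_self2)
    also have "\<dots> = (e mod H + k) mod H"
      by (simp add: mod_simps)
    finally have *: "(e + n) mod H = (e mod H + k) mod H" .
    have "e mod H < H" using \<open>k > 0\<close> by (simp add: H_def)
    show ?thesis
    proof (cases "e mod H < k")
      case True
      then have "(e + n) mod H = e mod H + k" unfolding * by (simp add: H_def)
      then show ?thesis using True by (simp add: S_def)
    next
      case False
      then have "(e mod H + k) mod H = e mod H + k - H"
        using \<open>e mod H < H\<close> by (subst mod_if) (simp add: H_def)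
      then show ?thesis using False \<open>e mod H < H\<close> unfolding S_def * by (simp add: H_def)
    qed
  qed
  have "n > 1" using \<open>even n\<close> n_pos by (cases "n = 1") auto
  moreover have "\<not> 2 * n dvd H"
    using \<open>k > 0\<close> \<open>q > 1\<close> by (simp add: H_def k)
  moreover have "even H" by (simp add: H_def)
  ultimately obtain \<alpha> l m where \<alpha>: "odd \<alpha>" "[1 - g ^ \<alpha> = g ^ l] (mod p)"
    "[1 - g ^ (\<alpha> + H) = g ^ m] (mod p)" "odd (l + m)"
    by (rule nonresidue_shift)
  define Y where "Y e = (if S e then \<alpha> + e else \<alpha> + (H + e))" for e
  define L where "L e = (if S e then l + e else m + e)" for e
  have eq_if_cong_2n: "e = e'" if "e < 2 * n" "e' < 2 * n" "[e = e'] (mod (2 * n))" for e e'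
    using that by (simp add: cong_def)
  \<comment> \<open>A common partner would make \<open>e\<close> congruent to \<open>H + e'\<close>,
    but adding \<open>H\<close> does not change membership in \<open>S\<close>.\<close>
  have mixed_Y: False if "S e" "\<not> S e'" "[Y e = Y e'] (mod (2 * n))" for e e'
  proof -
    have "[e = H + e'] (mod (2 * n))"
      using that by (simp add: Y_def cong_add_lcancel_nat)
    then show False using S_cong that by (fastforce simp: S_def)
  qed
  \<comment> \<open>\<open>n\<close> is even, so congruence mod \<open>n\<close> preserves parity,
    whereas \<open>l + e\<close> and \<open>m + e'\<close> have different parities.\<close>
  have mixed_L: False if "S e" "\<not> S e'" "even e" "even e'" "[L e = L e'] (mod n)" for e e'
  proof -
    have "[l + e = m + e'] (mod 2)"
      using that \<open>even n\<close> by (auto simp: L_def intro: cong_dvd_modulus_nat)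
    then have "even (l + e) \<longleftrightarrow> even (m + e')"
      by (rule cong_dvd_iff)
    then show False using \<alpha>(4) that by simp
  qed
  show ?thesis
  proof (rule rainbow_one_factor[where u = "2 * n" and Y = Y and L = L]; (elim CollectE conjE)?)
    fix e assume "e < 2 * n" "even e"
    then show "odd (Y e)" using \<open>odd \<alpha>\<close> \<open>even H\<close> by (simp add: Y_def)
  next
    fix e e' assume *: "e < 2 * n" "e' < 2 * n" "[Y e = Y e'] (mod (2 * n))"
    have "S e \<longleftrightarrow> S e'" using mixed_Y * cong_sym by blast
    then have "[e = e'] (mod (2 * n))"
      using * by (auto simp: Y_def cong_add_lcancel_nat split: if_splits)
    then show "e = e'" using * eq_if_cong_2n by blast
  next
    fix e assume "e < 2 * n"
    have "[g ^ e * (1 - g ^ \<alpha>) = g ^ e * g ^ l] (mod p)"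
      "[g ^ e * (1 - g ^ (\<alpha> + H)) = g ^ e * g ^ m] (mod p)"
      using \<alpha> by (simp_all add: cong_scalar_left)
    then show "[(if e = 2 * n then 0 else g ^ e) - g ^ Y e = g ^ L e] (mod p)"
      using \<open>e < 2 * n\<close> by (simp add: Y_def L_def power_add algebra_simps)
  next
    fix e e' assume *: "e < 2 * n" "even e" "e' < 2 * n" "even e'" "[L e = L e'] (mod n)"
    have same: "S e \<longleftrightarrow> S e'" using mixed_L * cong_sym by blast
    then have "[e = e'] (mod n)"
      using * by (auto simp: L_def cong_add_lcancel_nat split: if_splits)
    moreover have "e = (if e < n then e mod n else e mod n + n)" if "e < 2 * n" for e
      using that by (cases "e < n") (simp_all add: le_mod_geq)
    \<comment> \<open>Exponents that differ by \<open>n\<close> belong to opposite residues, of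
      which only one lies in \<open>S\<close>.\<close>
    ultimately have "e = e' \<or> e = e' + n \<or> e' = e + n"
      using * unfolding cong_def by (metis (no_types))
    then show "e = e'" using S_add_n same by blast
  qed
qed

subsection \<open>Fermat primes\<close>

text \<open>Odd exponents are prime to \<open>2 * n\<close>, a power of 2, so it is enough that 3 is
  a non-residue. Otherwise -3 would have a square root \<open>s\<close>, and
  \<open>(s - 1) / 2\<close> would be a nontrivial cube root of unity, although 3 does not divide
  the group order \<open>2 * n\<close>.\<close>

lemma primitive_root_3:
  assumes "n = 2 ^ j" "n > 1"
  shows "primitive_root p 3 n"
proof -
  have "even n" using assms by (cases j) auto
  then have "p \<ge> 5" using assms(2) p_eq by simp
  have not_dvd: "\<not> p dvd x" if "0 < x" "x < p" for x
    using that zdvd_imp_le by force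
  have coprime_2n: "coprime f (2 * n)" if "odd f" for f
    using that assms(1) by simp
  obtain f where f: "[3 = g ^ f] (mod p)"
    using not_dvd[of 3] \<open>p \<ge> 5\<close> power_rep by auto
  have "odd f"
  proof
    assume "even f"
    \<comment> \<open>Adding \<open>n\<close> to the exponent negates 3, and \<open>f + n\<close> is
      even, so \<open>s\<close> is a square root of -3.\<close>
    define s where "s = g ^ ((f + n) div 2)"
    have "s ^ 2 = g ^ (f + n)"
      using \<open>even f\<close> \<open>even n\<close> by (simp add: s_def flip: power_mult)
    also have "[\<dots> = - (g ^ f)] (mod p)" by (rule power_add_n)
    also have "[- (g ^ f) = - 3] (mod p)"
      using f by (simp add: cong_minus_minus_iff cong_sym_eq)
    finally have s: "p dvd s ^ 2 + 3" by (simp add: cong_iff_dvd_diff)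
    have "(s - 1) ^ 3 - 2 ^ 3 = (s ^ 2 + 3) * (s - 3)"
      by (simp add: power3_eq_cube power2_eq_square algebra_simps)
    then have cube: "[(s - 1) ^ 3 = 2 ^ 3] (mod p)"
      using s by (simp add: cong_iff_dvd_diff)
    obtain c where c: "[2 = g ^ c] (mod p)"
      using not_dvd[of 2] \<open>p \<ge> 5\<close> power_rep by auto
    have "\<not> p dvd 2" "\<not> p dvd 3"
      using not_dvd[of 2] not_dvd[of 3] \<open>p \<ge> 5\<close> by simp_all
    then have "\<not> p dvd 2 ^ 3"
      using prime_dvd_power[OF p_prime] by blast
    then have "\<not> p dvd s - 1"
      using cong_dvd_iff[OF cube] by (auto simp: power3_eq_cube)
    then obtain d where d: "[s - 1 = g ^ d] (mod p)"
      by (rule power_rep)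
    have "[(g ^ d) ^ 3 = (g ^ c) ^ 3] (mod p)"
      using cube cong_pow[OF c, of 3] cong_pow[OF d, of 3] by (meson cong_sym cong_trans)
    then have "[d * 3 = c * 3] (mod (2 * n))"
      by (simp add: power_cong_iff flip: power_mult)
    then have "[d = c] (mod (2 * n))"
      using coprime_2n[of 3] by (simp add: cong_mult_rcancel_nat)
    then have "[s - 1 = 2] (mod p)"
      using c d power_cong_iff by (meson cong_sym cong_trans)
    then have "p dvd s - 3" by (simp add: cong_iff_dvd_diff)
    \<comment> \<open>With \<open>s\<close> congruent to 3, the equation for \<open>s\<close> leaves
      that \<open>p\<close> divides 12.\<close>
    then have "p dvd (s ^ 2 + 3) - (s - 3) * (s + 3)"
      by (rule dvd_diff[OF s dvd_mult2])
    also have "(s ^ 2 + 3) - (s - 3) * (s + 3) = 2 ^ 2 * 3"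
      by (simp add: power2_eq_square algebra_simps)
    finally show False
      using \<open>\<not> p dvd 2\<close> \<open>\<not> p dvd 3\<close> prime_dvd_power[OF p_prime]
      unfolding prime_dvd_mult_iff[OF p_prime] by blast
  qed
  have "[3 ^ a = 3 ^ b] (mod p) \<longleftrightarrow> [a = b] (mod (2 * n))" for a b
  proof -
    have "[3 ^ a = g ^ (f * a)] (mod p)" for a
      using cong_pow[OF f, of a] by (simp add: power_mult)
    then have "[3 ^ a = 3 ^ b] (mod p) \<longleftrightarrow> [g ^ (f * a) = g ^ (f * b)] (mod p)"
      by (meson cong_sym cong_trans)
    also have "\<dots> \<longleftrightarrow> [a = b] (mod (2 * n))"
      using coprime_2n[OF \<open>odd f\<close>] by (simp add: power_cong_iff cong_mult_lcancel_nat)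
    finally show ?thesis .
  qed
  then show ?thesis
    using p_prime p_eq by (simp add: primitive_root_def)
qed

text \<open>For \<open>n = 4 * k\<close>, \<open>z = g ^ k\<close> is a primitive eighth root of
  unity with inverse \<open>- (z ^ 3)\<close>, and the square of \<open>z + 1/z\<close> is
  2.\<close>

lemma two_eq_even_power:
  assumes "4 dvd n"
  obtains w where "even w" "w < 2 * n" "[2 = g ^ w] (mod p)"
proof -
  obtain k where k: "n = 4 * k" using assms ..
  have "(g ^ k - g ^ (3 * k)) ^ 2 - 2 = (g ^ n + 1) * (g ^ (2 * k) - 2)"
    by (simp add: k power2_eq_square mult_2_right algebra_simps flip: power_add)
  then have *: "[(g ^ k - g ^ (3 * k)) ^ 2 = 2] (mod p)"
    using power_n by (simp add: cong_iff_dvd_diff)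
  have "\<not> p dvd 2" using p_gt_2 zdvd_imp_le by force
  then obtain w where w: "w < 2 * n" "[2 = g ^ w] (mod p)"
    by (rule power_rep)
  have "QuadRes p (g ^ w)"
    unfolding QuadRes_def using cong_trans[OF * w(2)] by blast
  then show thesis using that w QuadRes_power_iff by blast
qed

end

lemma rainbow_one_factor_3:
  assumes "primitive_root p 3 n" "4 dvd n"
  shows "has_balanced_rainbow_factor p"
proof -
  interpret primitive_root p 3 n by fact
  obtain w where w: "even w" "w < 2 * n" "[2 = 3 ^ w] (mod p)"
    using two_eq_even_power[OF \<open>4 dvd n\<close>] by blast
  have "even n" using \<open>4 dvd n\<close> by (meson dvd_trans even_numeral)
  have "n \<ge> 4" using \<open>4 dvd n\<close> n_pos by (simp add: dvd_imp_le)
  then have "p > 3" using p_eq by simp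
  have "w \<noteq> 0"
  proof
    assume "w = 0"
    then have "p dvd 1" using w(3) by (simp add: cong_iff_dvd_diff)
    then show False using p_gt_2 zdvd_imp_le by force
  qed
  have "w \<noteq> n"
  proof
    assume "w = n"
    then have "[2 = -1] (mod p)" using w(3) power_n cong_trans by blast
    then have "p dvd 3" by (simp add: cong_iff_dvd_diff)
    then show False using \<open>p > 3\<close> zdvd_imp_le by force
  qed
  \<comment> \<open>The logarithms of 2 and -2 differ by \<open>n\<close>, so exactly one of them
    exceeds \<open>n\<close>.\<close>
  define u where "u = (if n < w then w else w + n)"
  have u: "even u" "n < u" "u < 2 * n" "[w = u] (mod n)"
    using w \<open>w \<noteq> 0\<close> \<open>w \<noteq> n\<close> \<open>even n\<close> by (auto simp: u_def cong_def)
  \<comment> \<open>The shifts by 1 use every odd exponent except \<open>2 * n - 1\<close>, the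
    logarithm of 1/3, which is left for \<open>e = n\<close>.\<close>
  define Y where "Y e = (if e < n then e + 1 else if e = n then 2 * n - 1 else e - 1)" for e
  define L where "L e = (if e < n then n + w + e else if e = n then n + 2 * w - 1
    else if e = u then n + u - 1 else w + e - 1)" for e
  \<comment> \<open>\<open>M e\<close> is \<open>L e - u\<close> reduced mod \<open>n\<close>. The
    cases \<open>e < n\<close> give the even values, the regular \<open>e > n\<close> the odd ones
    except \<open>u - 1 - n\<close> and \<open>n - 1\<close>; these two are taken by
    \<open>e = n\<close> and \<open>e = u\<close>.\<close>
  define M where "M e = (if e < n then e else if e = n then u - 1 - n
    else if e = u then n - 1 else e - 1 - n)" for e
  have L_cong: "[L e = u + M e] (mod n)" if "e < 2 * n" for e
  proof -
    have "L e = u + M e \<or> L e = u + M e + n \<or> L e = u + M e + 2 * n"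
      using that u by (auto simp: L_def M_def u_def)
    then show ?thesis by (auto simp: cong_def)
  qed
  have M_less: "M e < n" if "e < 2 * n" for e
    using that u by (auto simp: M_def)
  have M_inj: "e = e'" if "e < 2 * n" "even e" "e' < 2 * n" "even e'" "M e = M e'" for e e'
    using that u(1-3) \<open>even n\<close> unfolding M_def
    by (simp_all split: if_splits) presburger+
  show ?thesis
  proof (rule rainbow_one_factor[where u = u and Y = Y and L = L]; (elim CollectE conjE)?)
    fix e assume "e < 2 * n" "even e"
    then show "odd (Y e)" using \<open>even n\<close> n_pos by (auto simp: Y_def)
  next
    fix e e' assume *: "e < 2 * n" "even e" "e' < 2 * n" "even e'" "[Y e = Y e'] (mod (2 * n))"
    moreover have "Y e < 2 * n" if "e < 2 * n" for e using that by (auto simp: Y_def)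
    ultimately have "Y e = Y e'" by (simp add: cong_def)
    then show "e = e'" using * \<open>even n\<close> unfolding Y_def
      by (simp_all split: if_splits) presburger+
  next
    fix e e' assume *: "e < 2 * n" "even e" "e' < 2 * n" "even e'" "[L e = L e'] (mod n)"
    then have "[u + M e = u + M e'] (mod n)"
      using L_cong by (meson cong_sym cong_trans)
    then have "[M e = M e'] (mod n)"
      by (simp add: cong_add_lcancel_nat)
    then show "e = e'" using * M_less M_inj by (simp add: cong_def)
  next
    fix e assume "e < 2 * n" "even e"
    have twice: "[2 * 3 ^ a = 3 ^ (w + a)] (mod p)" for a
      using cong_scalar_right[OF w(3)] by (simp add: power_add)
    have minus: "[- (3 ^ a) = 3 ^ (n + a)] (mod p)" for a
      using power_add_n[of a] by (simp add: add.commute cong_sym_eq)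
    consider "e < n" | "e = n" | "e = u" | "e > n" "e \<noteq> u" by linarith
    then show "[(if e = u then 0 else 3 ^ e) - 3 ^ Y e = 3 ^ L e] (mod p)"
    proof cases
      case 1
      have "[- (2 * 3 ^ e) = - (3 ^ (w + e))] (mod p)"
        using twice by (simp add: cong_minus_minus_iff)
      also have "[- (3 ^ (w + e)) = 3 ^ (n + (w + e))] (mod p)" by (rule minus)
      finally show ?thesis using 1 u by (simp add: Y_def L_def add.assoc)
    next
      case 2
      have "[3 ^ n - 3 ^ (n - 1 + n) = 3 ^ n - - (3 ^ (n - 1))] (mod p)"
        using power_add_n by (intro cong_diff) auto
      also have "(3 :: int) ^ n - - (3 ^ (n - 1)) = 2 * (2 * 3 ^ (n - 1))"
        using n_pos by (cases n) auto
      also have "[\<dots> = 2 * 3 ^ (w + (n - 1))] (mod p)"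
        using twice by (rule cong_scalar_left)
      also have "[2 * 3 ^ (w + (n - 1)) = 3 ^ (w + (w + (n - 1)))] (mod p)" by (rule twice)
      also have "w + (w + (n - 1)) = n + 2 * w - 1" using n_pos by simp
      also have "n - 1 + n = 2 * n - 1" using n_pos by simp
      finally show ?thesis using 2 u by (simp add: Y_def L_def)
    next
      case 3
      then show ?thesis using minus[of "u - 1"] u by (simp add: Y_def L_def)
    next
      case 4
      then have "(3 :: int) ^ e - 3 ^ (e - 1) = 2 * 3 ^ (e - 1)"
        by (cases e) auto
      then show ?thesis using 4 twice[of "e - 1"] by (simp add: Y_def L_def)
    qed
  qed
qed

text \<open>Modulo 5, 2 and -2 are non-residues and cannot be joined to the centre. With
  \<open>u = 0\<close> the centre gets 1 instead.\<close>

lemma rainbow_one_factor_5: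
  assumes "primitive_root p 3 2"
  shows "has_balanced_rainbow_factor p"
proof -
  interpret primitive_root p 3 2 by fact
  have "e < 4 \<and> even e \<longleftrightarrow> e = 0 \<or> e = 2" for e :: nat
    by presburger
  then have E: "{e. e < 2 * 2 \<and> even e} = {0, 2 :: nat}"
    by auto
  have p: "p = 5" using p_eq by simp
  show ?thesis
    by (rule rainbow_one_factor[where u = 0 and Y = "\<lambda>e. if e = 0 then 3 else 1"
          and L = "\<lambda>e. if e = 0 then 1 else 0"]; unfold E p; auto simp: cong_def)
qed

subsection \<open>All odd primes\<close>

lemma odd_prime_has_balanced_rainbow_factor:
  fixes p :: int
  assumes "prime p" and "odd p"
  shows "has_balanced_rainbow_factor p"
proof -
  obtain g n where "primitive_root p g n"
    using primitive_root_exists[OF assms] .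
  then interpret primitive_root p g n .
  obtain j q where q: "n = 2 ^ j * q" "odd q"
    using n_pos by (metis multiplicity_decompose' neq0_conv two_is_prime_nat not_prime_unit)
  show ?thesis
  proof (cases "q = 1")
    case True
    then have n: "n = 2 ^ j" using q by simp
    \<comment> \<open>These are \<open>p = 3\<close>, where \<open>n = 1\<close> is odd, then
      \<open>p = 5\<close>, and the primes with \<open>4 dvd n\<close>.\<close>
    consider "j = 0" | "j = 1" | i where "j = Suc (Suc i)"
      by (metis One_nat_def not0_implies_Suc)
    then show ?thesis
    proof cases
      case 1
      then show ?thesis using n rainbow_one_factor_odd by simp
    next
      case 2
      then have "primitive_root p 3 2"
        using primitive_root_3[of 1] n by simp
      then show ?thesis by (rule rainbow_one_factor_5)
    next
      case 3
      then have "4 dvd n" using n by simp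
      moreover have "n > 1" using dvd_imp_le[OF \<open>4 dvd n\<close> n_pos] by simp
      ultimately show ?thesis
        using rainbow_one_factor_3 primitive_root_3 n by blast
    qed
  next
    case False
    show ?thesis
    proof (cases "even n")
      case True
      have "q > 1" using False q n_pos by (cases q) auto
      then show ?thesis
        using rainbow_one_factor_odd_divisor[OF True \<open>odd q\<close>] q by simp
    qed (rule rainbow_one_factor_odd)
  qed
qed

theorem theorem1p2:
  fixes p :: int
  assumes "prime p" and "odd p"
  shows "\<exists>F. one_factor p F
    \<and> (\<forall>e\<in>F. \<exists>u v. e = {u, v} \<and> is_residue p u \<and> \<not> is_residue p v)
    \<and> inj_on (edge_len p) F"
  using odd_prime_has_balanced_rainbow_factor[OF assms]
  unfolding has_balanced_rainbow_factor_def .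

end
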